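(* Consider the optimization problem $$\min_{(G,\mathcal M)}\ \mathrm{Trace}(\mathcal M\,\mathcal B(G))\quad\text{s.t.}\quad\sigma(S-GL)\subset\mathbb C^-,\quad\mathcal A(G)^T\mathcal M+\mathcal M\mathcal A(G)+\mathcal C=0,$$ with Lagrangian $$\Gamma(\mathcal W,\mathcal M,G)=\mathrm{Trace}(\mathcal M\,\mathcal B(G))+\mathrm{Trace}\big(\mathcal W(\mathcal A(G)^T\mathcal M+\mathcal M\mathcal A(G)+\mathcal C)\big),$$ where $\mathcal W,\mathcal M$ are symmetric $(n+\nu)\times(n+\nu)$ real matrices and $G\in\mathbb R^{\nu\times m}$. The KKT system $\nabla\Gamma(\mathcal W,\mathcal M,G)=0$ of this problem is given by $$\nabla\Gamma(\mathcal W,\mathcal M,G)=0\iff\begin{cases}\mathcal A(G)^T\mathcal M+\mathcal M\mathcal A(G)+\mathcal C=0,\\ \mathcal A(G)\mathcal W+\mathcal W\mathcal A(G)^T+\mathcal B(G)=0,\\ M_{12}^TB+M_{22}G-M_{12}^TW_{12}L^T-M_{22}W_{22}L^T=0.\end{cases}$$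
   Context: Let $A\in\mathbb R^{n\times n}$, $B\in\mathbb R^{n\times m}$, $C\in\mathbb R^{p\times n}$ be a minimal realization of a linear time-invariant system $\dot x=Ax+Bu$, $y=Cx$, with $A$ stable: $\sigma(A)\subset\mathbb C^-$ ($\sigma$ is the spectrum, $\mathbb C^-$ the open left half plane). Fix $S\in\mathbb R^{\nu\times\nu}$ and $L\in\mathbb R^{m\times\nu}$ with the pair $(L,S)$ observable and $\sigma(S)\cap\sigma(A)=\emptyset$, and let $\Pi\in\mathbb R^{n\times\nu}$ be the unique solution of the Sylvester equation $A\Pi+BL=\Pi S$. Define $$\mathcal A(G)=\begin{bmatrix}A&0\\ 0&S-GL\end{bmatrix},\quad\mathcal B(G)=\begin{bmatrix}B\\ G\end{bmatrix}\begin{bmatrix}B\\ G\end{bmatrix}^T,\quad\mathcal C=\begin{bmatrix}I\\ -\Pi^T\end{bmatrix}C^TC\begin{bmatrix}I&-\Pi\end{bmatrix}.$$ Symmetric $(n+\nu)\times(n+\nu)$ matrices are partitioned as $\mathcal W=\begin{bmatrix}W_{11}&W_{12}\\ W_{12}^T&W_{22}\end{bmatrix}$, $\mathcal M=\begin{bmatrix}M_{11}&M_{12}\\ M_{12}^T&M_{22}\end{bmatrix}$ with $W_{11},M_{11}\in\mathbb R^{n\times n}$ and $W_{22},M_{22}\in\mathbb R^{\nu\times\nu}$. $\nabla\Gamma=(\nabla_{\mathcal W}\Gamma,\nabla_{\mathcal M}\Gamma,\nabla_G\Gamma)$ denotes the gradient with respect to the trace inner product $\langle U,V\rangle=\mathrm{Trace}(U^TV)$.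 *)

theory Defs
  imports "HOL-Analysis.Analysis"
begin

section \<open>Spectrum\<close>

abbreviation cmat :: "real^'a^'b \<Rightarrow> complex^'a^'b" where
  "cmat \<equiv> map_matrix complex_of_real"

definition spectrum :: "real^'n^'n \<Rightarrow> complex set" where
  "spectrum A = {z. \<exists>v::complex^'n. v \<noteq> 0 \<and> cmat A *v v = z *s v}"

definition left_half_plane :: "complex set" where
  "left_half_plane = {z. Re z < 0}"

section \<open>Linear time-invariant systems\<close>

text \<open>A pair \<open>(C, A)\<close> is observable if the initial state of a trajectory of \<open>x' = A x\<close>
  is determined by the output \<open>y = C x\<close> on \<open>[0, \<infinity>)\<close>.\<close>

definition free_trajectory :: "real^'n^'n \<Rightarrow> (real \<Rightarrow> real^'n) \<Rightarrow> bool" where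
  "free_trajectory A x \<longleftrightarrow>
     (\<forall>t\<ge>0. (x has_vector_derivative A *v x t) (at t within {0..}))"

definition observable :: "real^'n^'p \<Rightarrow> real^'n^'n \<Rightarrow> bool" where
  "observable C A \<longleftrightarrow>
     (\<forall>x x'. free_trajectory A x \<and> free_trajectory A x' \<and>
        (\<forall>t\<ge>0. C *v x t = C *v x' t) \<longrightarrow> x 0 = x' 0)"

definition transfer_function ::
    "real^'n^'n \<Rightarrow> real^'m^'n \<Rightarrow> real^'n^'p \<Rightarrow> complex \<Rightarrow> complex^'m^'p" where
  "transfer_function A B C s = cmat C ** matrix_inv (mat s - cmat A) ** cmat B"

text \<open>Realizations of arbitrary order \<open>k\<close> are needed to say that a given one has least order, so
  the state is indexed by \<open>{..<k}\<close> here and \<open>a\<close>, \<open>b\<close>, \<open>c\<close> are the entries of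
  the system matrices. The transfer function \<open>c (s I - a)\<^sup>-\<^sup>1 b\<close> is expressed by solving
  \<open>s x = a x + b u\<close>, \<open>y = c x\<close>, which is uniquely possible for all \<open>s\<close> of
  large modulus; there, agreement of two such rational functions means that they are equal.\<close>

definition realizes ::
    "(complex \<Rightarrow> complex^'m^'p) \<Rightarrow> nat \<Rightarrow>
     (nat \<Rightarrow> nat \<Rightarrow> real) \<Rightarrow> (nat \<Rightarrow> 'm \<Rightarrow> real) \<Rightarrow> ('p \<Rightarrow> nat \<Rightarrow> real) \<Rightarrow> bool" where
  "realizes H k a b c \<longleftrightarrow>
     (\<forall>\<^sub>F s in at_infinity. \<forall>u::complex^'m. \<exists>x::nat \<Rightarrow> complex.
        (\<forall>i<k. s * x i = (\<Sum>j<k. complex_of_real (a i j) * x j)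
                        + (\<Sum>l\<in>UNIV. complex_of_real (b i l) * u $ l)) \<and>
        H s *v u = (\<chi> q. \<Sum>i<k. complex_of_real (c q i) * x i))"

definition minimal_realization ::
    "real^'n^'n \<Rightarrow> real^'m^'n \<Rightarrow> real^'n^'p \<Rightarrow> bool" where
  "minimal_realization A B C \<longleftrightarrow>
     (\<forall>k a b c. realizes (transfer_function A B C) k a b c \<longrightarrow> CARD('n) \<le> k)"

section \<open>Block matrices\<close>

definition block_mat ::
    "real^'a^'c \<Rightarrow> real^'b^'c \<Rightarrow> real^'a^'d \<Rightarrow> real^'b^'d \<Rightarrow> real^('a+'b)^('c+'d)" where
  "block_mat P Q R T = (\<chi> i j.
     case i of
       Inl i1 \<Rightarrow> (case j of Inl j1 \<Rightarrow> P $ i1 $ j1 | Inr j2 \<Rightarrow> Q $ i1 $ j2)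
     | Inr i2 \<Rightarrow> (case j of Inl j1 \<Rightarrow> R $ i2 $ j1 | Inr j2 \<Rightarrow> T $ i2 $ j2))"

definition block_col :: "real^'a^'c \<Rightarrow> real^'a^'d \<Rightarrow> real^'a^('c+'d)" where
  "block_col P R = (\<chi> i j. case i of Inl i1 \<Rightarrow> P $ i1 $ j | Inr i2 \<Rightarrow> R $ i2 $ j)"

definition block_row :: "real^'a^'c \<Rightarrow> real^'b^'c \<Rightarrow> real^('a+'b)^'c" where
  "block_row P Q = (\<chi> i j. case j of Inl j1 \<Rightarrow> P $ i $ j1 | Inr j2 \<Rightarrow> Q $ i $ j2)"

definition sym_mats :: "(real^'a^'a) set" where
  "sym_mats = {X. transpose X = X}"

section \<open>Gradients\<close>

text \<open>The inner product of the type \<open>real^'a^'b\<close> is the trace inner product, and that of a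
  product type is the sum of the inner products of the components.\<close>

lemma inner_eq_trace: "U \<bullet> V = trace (transpose U ** V)"
  for U V :: "real^'a^'b"
  unfolding trace_def matrix_matrix_mult_def transpose_def inner_vec_def
  by (simp, rule sum.swap)

text \<open>Gradient at \<open>x \<in> V\<close> of a function on a linear subspace \<open>V\<close>, with respect to
  the inner product of \<open>V\<close>; the gradient is itself an element of \<open>V\<close>.\<close>

definition gradient_on :: "'a::euclidean_space set \<Rightarrow> ('a \<Rightarrow> real) \<Rightarrow> 'a \<Rightarrow> 'a" where
  "gradient_on V f x =
     (THE g. g \<in> V \<and> (f has_derivative (\<lambda>h. h \<bullet> g)) (at x within V))"

section \<open>The optimization problem and its Lagrangian\<close>

text \<open>The solution of the Sylvester equation is called \<open>P\<close>, since \<open>Pi\<close> is taken by the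
  library. Throughout, \<open>'n\<close> indexes the states, \<open>'m\<close> the inputs, \<open>'p\<close> the outputs of
  \<open>(A, B, C)\<close>, and \<open>'v\<close> the states of \<open>S\<close>.\<close>

definition calA ::
    "real^'n^'n \<Rightarrow> real^'v^'v \<Rightarrow> real^'v^'m \<Rightarrow> real^'m^'v \<Rightarrow> real^('n+'v)^('n+'v)" where
  "calA A S L G = block_mat A 0 0 (S - G ** L)"

definition calB :: "real^'m^'n \<Rightarrow> real^'m^'v \<Rightarrow> real^('n+'v)^('n+'v)" where
  "calB B G = block_col B G ** transpose (block_col B G)"

definition calC :: "real^'n^'p \<Rightarrow> real^'v^'n \<Rightarrow> real^('n+'v)^('n+'v)" where
  "calC C P = block_col (mat 1) (- transpose P) ** transpose C ** C
                 ** block_row (mat 1) (- P)"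

definition objective :: "real^'m^'n \<Rightarrow> real^('n+'v)^('n+'v) \<Rightarrow> real^'m^'v \<Rightarrow> real" where
  "objective B M G = trace (M ** calB B G)"

definition residual ::
    "real^'n^'n \<Rightarrow> real^'n^'p \<Rightarrow> real^'v^'v \<Rightarrow> real^'v^'m \<Rightarrow> real^'v^'n \<Rightarrow>
     real^('n+'v)^('n+'v) \<Rightarrow> real^'m^'v \<Rightarrow> real^('n+'v)^('n+'v)" where
  "residual A C S L P M G =
     transpose (calA A S L G) ** M + M ** calA A S L G + calC C P"

text \<open>The problem is to minimize \<open>objective B M G\<close> over the \<open>(G, M)\<close> with \<open>M\<close>
  symmetric, \<open>spectrum (S - G ** L) \<subseteq> left_half_plane\<close> and
  \<open>residual A C S L P M G = 0\<close>. The spectral constraint is open and has no multiplier.\<close>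

definition lagrangian ::
    "real^'n^'n \<Rightarrow> real^'m^'n \<Rightarrow> real^'n^'p \<Rightarrow> real^'v^'v \<Rightarrow> real^'v^'m \<Rightarrow> real^'v^'n \<Rightarrow>
     (real^('n+'v)^('n+'v)) \<times> (real^('n+'v)^('n+'v)) \<times> (real^'m^'v) \<Rightarrow> real" where
  "lagrangian A B C S L P = (\<lambda>(W, M, G).
     objective B M G + trace (W ** residual A C S L P M G))"

definition grad_lagrangian ::
    "real^'n^'n \<Rightarrow> real^'m^'n \<Rightarrow> real^'n^'p \<Rightarrow> real^'v^'v \<Rightarrow> real^'v^'m \<Rightarrow> real^'v^'n \<Rightarrow>
     (real^('n+'v)^('n+'v)) \<times> (real^('n+'v)^('n+'v)) \<times> (real^'m^'v) \<Rightarrow>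
     (real^('n+'v)^('n+'v)) \<times> (real^('n+'v)^('n+'v)) \<times> (real^'m^'v)" where
  "grad_lagrangian A B C S L P =
     gradient_on (sym_mats \<times> sym_mats \<times> UNIV) (lagrangian A B C S L P)"

end

theory Submission
  imports Defs
begin

text \<open>On symmetric directions \<open>(U, X, H)\<close> the derivative of the Lagrangian equals
  \<open>\<langle>U, residual\<rangle> + \<langle>X, \<A>W + W\<A>\<^sup>T + \<B>\<rangle> + 2\<langle>H, K\<rangle>\<close> with \<open>K\<close> the left-hand side of the third
  equation, because the trace is invariant under transposition and cyclic permutation. The first
  two components are symmetric, so this triple is the gradient on the subspace.\<close>

section \<open>Gradients relative to a linear subspace\<close>

text \<open>A derivative within \<open>V\<close> is determined only along \<open>V\<close>, which
  may have empty interior. Restricting \<open>f\<close> to the line through \<open>x\<close> in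
  direction \<open>h\<close> reduces the claim to uniqueness in one real variable.\<close>

lemma has_derivative_within_subspace_unique:
  assumes V: "subspace V" and x: "x \<in> V" and h: "h \<in> V"
    and f': "(f has_derivative f') (at x within V)"
    and f'': "(f has_derivative f'') (at x within V)"
  shows "f' h = f'' h"
proof -
  have d: "((\<lambda>t. f (x + t *\<^sub>R h)) has_derivative (\<lambda>t. F (t *\<^sub>R h))) (at 0)"
    if F: "(f has_derivative F) (at x within V)" for F
  proof -
    have "((\<lambda>t::real. x + t *\<^sub>R h) has_derivative (\<lambda>t. t *\<^sub>R h)) (at 0)"
      by (auto intro!: derivative_eq_intros)
    \<comment> \<open>The whole line lies in \<open>V\<close>, so the derivative within
      \<open>V\<close> restricts to it and the chain rule applies.\<close>
    moreover have "(f has_derivative F) (at (x + 0 *\<^sub>R h) within range (\<lambda>t. x + t *\<^sub>R h))"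
      using F V x h by (auto intro: has_derivative_subset subspace_add subspace_scale)
    ultimately show ?thesis
      by (rule has_derivative_in_compose)
  qed
  show ?thesis
    using fun_cong[OF has_derivative_unique[OF d[OF f'] d[OF f'']], of 1] by simp
qed

text \<open>The difference quotient within \<open>V\<close> evaluates the linear map only at
  \<open>y - x\<close>, which lies in \<open>V\<close>. Hence a trace formula may be exchanged for
  an inner product that agrees with it only on symmetric directions.\<close>

lemma has_derivative_within_subspace_transform:
  assumes V: "subspace V" and x: "x \<in> V"
    and f: "(f has_derivative f') (at x within V)"
    and lin: "bounded_linear f''" and eq: "\<And>h. h \<in> V \<Longrightarrow> f'' h = f' h"
  shows "(f has_derivative f'') (at x within V)"
proof -
  have "((\<lambda>y. (1 / norm (y - x)) *\<^sub>R (f y - (f x + f' (y - x)))) \<longlongrightarrow> 0) (at x within V)"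
    using f by (simp add: has_derivative_within)
  then have "((\<lambda>y. (1 / norm (y - x)) *\<^sub>R (f y - (f x + f'' (y - x)))) \<longlongrightarrow> 0) (at x within V)"
    by (rule Lim_transform_within[OF _ zero_less_one]) (simp add: eq subspace_diff V x)
  then show ?thesis
    using lin by (simp add: has_derivative_within)
qed

lemma gradient_on_eqI:
  assumes V: "subspace V" and x: "x \<in> V" and g: "g \<in> V"
    and f: "(f has_derivative f') (at x within V)"
    and eq: "\<And>h. h \<in> V \<Longrightarrow> f' h = h \<bullet> g"
  shows "gradient_on V f x = g"
  unfolding gradient_on_def
proof (rule the_equality)
  have *: "(f has_derivative (\<lambda>h. h \<bullet> g)) (at x within V)"
    by (rule has_derivative_within_subspace_transform[OF V x f bounded_linear_inner_left])
      (simp add: eq)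
  then show "g \<in> V \<and> (f has_derivative (\<lambda>h. h \<bullet> g)) (at x within V)"
    using g by simp
  fix g' assume g': "g' \<in> V \<and> (f has_derivative (\<lambda>h. h \<bullet> g')) (at x within V)"
  \<comment> \<open>Testing both derivatives on the direction \<open>g' - g\<close>, which lies in
    \<open>V\<close>, makes the difference orthogonal to itself.\<close>
  then have "(g' - g) \<bullet> g' = (g' - g) \<bullet> g"
    using has_derivative_within_subspace_unique[OF V x, of "g' - g"] * g V
    by (blast intro: subspace_diff)
  then have "(g' - g) \<bullet> (g' - g) = 0"
    by (simp add: inner_diff_right)
  then show "g' = g"
    by simp
qed

section \<open>Differentiation rules for matrix operations and blocks\<close>

lemma bounded_bilinear_matrix_matrix_mult:
  "bounded_bilinear ((**) :: real^'b^'a \<Rightarrow> real^'c^'b \<Rightarrow> real^'c^'a)"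
  unfolding bilinear_conv_bounded_bilinear[symmetric] bilinear_def
  by (auto intro!: linearI
      simp: vec_eq_iff matrix_matrix_mult_def algebra_simps sum.distrib sum_distrib_left)

lemma bounded_linear_transpose: "bounded_linear (transpose :: real^'a^'b \<Rightarrow> real^'b^'a)"
  unfolding linear_conv_bounded_linear[symmetric]
  by (auto intro!: linearI simp: vec_eq_iff transpose_def)

lemma bounded_linear_trace: "bounded_linear (trace :: real^'a^'a \<Rightarrow> real)"
  unfolding linear_conv_bounded_linear[symmetric]
  by (auto intro!: linearI simp: trace_def sum.distrib sum_distrib_left)

lemmas has_derivative_matrix_mult [derivative_intros] =
  bounded_bilinear.FDERIV[OF bounded_bilinear_matrix_matrix_mult]
lemmas has_derivative_transpose [derivative_intros] =
  bounded_linear.has_derivative[OF bounded_linear_transpose]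
lemmas has_derivative_trace [derivative_intros] =
  bounded_linear.has_derivative[OF bounded_linear_trace]

text \<open>The map is affine in its last block, the only block of \<open>calA\<close> that depends
  on \<open>G\<close>; the proof separates the constant part from the linear one.\<close>

lemma has_derivative_block_mat [derivative_intros]:
  fixes f :: "'z::real_normed_vector \<Rightarrow> real^'a^'b"
  assumes "(f has_derivative f') F"
  shows "((\<lambda>x. block_mat P Q R (f x)) has_derivative (\<lambda>h. block_mat 0 0 0 (f' h))) F"
proof -
  have "bounded_linear (block_mat 0 0 0 :: real^'a^'b \<Rightarrow> real^('c+'a)^('d+'b))"
    unfolding linear_conv_bounded_linear[symmetric]
    by (auto intro!: linearI simp: vec_eq_iff block_mat_def split: sum.splits)
  from bounded_linear.has_derivative[OF this assms]
  have "((\<lambda>x. block_mat P Q R 0 + block_mat 0 0 0 (f x)) has_derivative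
      (\<lambda>h. block_mat 0 0 0 (f' h))) F"
    by (auto intro!: derivative_eq_intros)
  moreover have "block_mat P Q R 0 + block_mat 0 0 0 (f x) = block_mat P Q R (f x)" for x
    by (auto simp: vec_eq_iff block_mat_def split: sum.splits)
  ultimately show ?thesis
    by simp
qed

lemma has_derivative_block_col [derivative_intros]:
  fixes f :: "'z::real_normed_vector \<Rightarrow> real^'a^'b"
  assumes "(f has_derivative f') F"
  shows "((\<lambda>x. block_col P (f x)) has_derivative (\<lambda>h. block_col 0 (f' h))) F"
proof -
  have "bounded_linear (block_col 0 :: real^'a^'b \<Rightarrow> real^'a^('c+'b))"
    unfolding linear_conv_bounded_linear[symmetric]
    by (auto intro!: linearI simp: vec_eq_iff block_col_def split: sum.splits)
  from bounded_linear.has_derivative[OF this assms]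
  have "((\<lambda>x. block_col P 0 + block_col 0 (f x)) has_derivative (\<lambda>h. block_col 0 (f' h))) F"
    by (auto intro!: derivative_eq_intros)
  moreover have "block_col P 0 + block_col 0 (f x) = block_col P (f x)" for x
    by (auto simp: vec_eq_iff block_col_def split: sum.splits)
  ultimately show ?thesis
    by simp
qed

section \<open>Trace inner product, block algebra and symmetry\<close>

lemma transpose_add: "transpose (X + Y) = transpose X + transpose (Y :: real^'a^'b)"
  by (simp add: vec_eq_iff transpose_def)

text \<open>By cyclicity of the trace, right multiplication by \<open>transpose Z\<close> is adjoint
  to right multiplication by \<open>Z\<close>. This isolates \<open>H\<close> in
  \<open>H ** L\<close>.\<close>

lemma inner_matrix_mult_right: "X \<bullet> (Y ** Z) = Y \<bullet> (X ** transpose Z)"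
  for X :: "real^'a^'b"
proof -
  have "X \<bullet> (Y ** Z) = trace ((transpose X ** Y) ** Z)"
    by (simp add: inner_eq_trace matrix_mul_assoc)
  also have "\<dots> = (X ** transpose Z) \<bullet> Y"
    by (subst trace_mul_sym) (simp add: inner_eq_trace matrix_transpose_mul matrix_mul_assoc)
  finally show ?thesis
    by (simp add: inner_commute)
qed

lemma sum_UNIV_Plus:
  "(\<Sum>i\<in>(UNIV::('a::finite + 'b::finite) set). f i) =
    (\<Sum>i\<in>UNIV. f (Inl i)) + (\<Sum>i\<in>UNIV. f (Inr i))"
  unfolding UNIV_Plus_UNIV[symmetric] by (simp add: sum.Plus del: UNIV_Plus_UNIV)

lemma block_mat_mult_block_mat:
  "block_mat P Q R T ** block_mat P' Q' R' T' =
     block_mat (P ** P' + Q ** R') (P ** Q' + Q ** T') (R ** P' + T ** R') (R ** Q' + T ** T')"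
  by (auto simp: vec_eq_iff block_mat_def matrix_matrix_mult_def sum_UNIV_Plus split: sum.splits)

lemma block_mat_mult_block_col:
  "block_mat P Q R T ** block_col P' R' = block_col (P ** P' + Q ** R') (R ** P' + T ** R')"
  by (auto simp: vec_eq_iff block_mat_def block_col_def matrix_matrix_mult_def sum_UNIV_Plus
      split: sum.splits)

lemma inner_block_mat:
  "block_mat P Q R T \<bullet> block_mat P' Q' R' T' = P \<bullet> P' + Q \<bullet> Q' + R \<bullet> R' + T \<bullet> T'"
  by (simp add: inner_vec_def block_mat_def sum_UNIV_Plus sum.distrib)

lemma inner_block_col: "block_col P R \<bullet> block_col P' R' = P \<bullet> P' + R \<bullet> R'"
  by (simp add: inner_vec_def block_col_def sum_UNIV_Plus)

lemma subspace_sym_mats: "subspace (sym_mats :: (real^'a^'a) set)"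
  by (auto simp: subspace_def sym_mats_def vec_eq_iff transpose_def)

text \<open>Transposition exchanges the two Lyapunov terms and fixes \<open>calC C P\<close>, whose
  outer factors are transposes of each other.\<close>

lemma sym_mats_residual:
  assumes "M \<in> sym_mats"
  shows "residual A C S L P M G \<in> sym_mats"
proof -
  have col: "transpose (block_row (mat 1) (- P)) = block_col (mat 1) (- transpose P)"
    by (auto simp: vec_eq_iff transpose_def block_row_def block_col_def mat_def split: sum.splits)
  then have "transpose (block_col (mat 1) (- transpose P)) = block_row (mat 1) (- P)"
    by (metis transpose_transpose)
  with col assms show ?thesis
    by (simp add: sym_mats_def residual_def calC_def transpose_add matrix_transpose_mul
        matrix_mul_assoc add.commute)
qed

lemma sym_mats_calB: "calB B G \<in> sym_mats"
  by (simp add: sym_mats_def calB_def matrix_transpose_mul)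

section \<open>Derivative and gradient of the Lagrangian\<close>

text \<open>This is the product rule in arbitrary directions; the minus signs come from
  \<open>S - G ** L\<close>.\<close>

lemma has_derivative_lagrangian:
  fixes A :: "real^'n^'n" and B :: "real^'m^'n" and C :: "real^'n^'p"
    and S :: "real^'v^'v" and L :: "real^'v^'m" and P :: "real^'v^'n"
  shows "(lagrangian A B C S L P has_derivative (\<lambda>(U, X, H).
     trace (X ** calB B G)
     + trace (M ** (block_col B G ** transpose (block_col 0 H)
                  + block_col 0 H ** transpose (block_col B G)))
     + trace (U ** residual A C S L P M G)
     + trace (W ** (transpose (calA A S L G) ** X + X ** calA A S L G
                  - transpose (block_mat 0 0 0 (H ** L)) ** M - M ** block_mat 0 0 0 (H ** L)))))
   (at (W, M, G) within V)"
proof -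
  \<comment> \<open>Projections replace the pattern match on triples, so that the derivative rules
    for \<open>fst\<close> and \<open>snd\<close> apply.\<close>
  have *: "lagrangian A B C S L P = (\<lambda>z.
      trace (fst (snd z) ** (block_col B (snd (snd z)) ** transpose (block_col B (snd (snd z)))))
      + trace (fst z ** (transpose (block_mat A 0 0 (S - snd (snd z) ** L)) ** fst (snd z)
          + fst (snd z) ** block_mat A 0 0 (S - snd (snd z) ** L) + calC C P)))"
    by (auto simp: lagrangian_def objective_def calB_def residual_def calA_def)
  have neg: "block_mat 0 0 0 (- Y) = - block_mat 0 0 0 Y" for Y :: "real^'v^'v"
    by (auto simp: vec_eq_iff block_mat_def split: sum.splits)
  have tneg: "transpose (- Y) = - transpose Y" for Y :: "real^('n+'v)^('n+'v)"
    by (simp add: vec_eq_iff transpose_def)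
  have mneg: "- Y ** Z = - (Y ** Z)" "Y ** - Z = - (Y ** Z)" for Y Z :: "real^('n+'v)^('n+'v)"
    by (simp_all add: vec_eq_iff matrix_matrix_mult_def sum_negf)
  show ?thesis
    unfolding *
    by (rule derivative_eq_intros refl)+
      (simp add: fun_eq_iff split_beta residual_def calA_def calB_def neg tneg mneg trace_add
        algebra_simps bounded_bilinear.zero_right[OF bounded_bilinear_matrix_matrix_mult])
qed

text \<open>The factor \<open>2\<close> arises because varying \<open>G\<close> changes both
  \<open>calB B G\<close> and the residual by a matrix plus its transpose; paired with symmetric
  \<open>M\<close> and \<open>W\<close>, the two halves contribute equally.\<close>

lemma grad_lagrangian_eq:
  fixes A :: "real^'n^'n" and B :: "real^'m^'n" and C :: "real^'n^'p"
    and S :: "real^'v^'v" and L :: "real^'v^'m" and P :: "real^'v^'n"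
    and W11 M11 :: "real^'n^'n" and W12 M12 :: "real^'v^'n" and W22 M22 :: "real^'v^'v"
  assumes W: "W \<in> sym_mats" and M: "M \<in> sym_mats"
    and Wb: "W = block_mat W11 W12 (transpose W12) W22"
    and Mb: "M = block_mat M11 M12 (transpose M12) M22"
  shows "grad_lagrangian A B C S L P (W, M, G) =
    (residual A C S L P M G,
     calA A S L G ** W + W ** transpose (calA A S L G) + calB B G,
     2 *\<^sub>R (transpose M12 ** B + M22 ** G
       - transpose M12 ** W12 ** transpose L - M22 ** W22 ** transpose L))"
    (is "_ = (?R, ?Q, 2 *\<^sub>R ?K)")
  unfolding grad_lagrangian_def
proof (rule gradient_on_eqI[OF _ _ _ has_derivative_lagrangian])
  have Wt: "transpose W = W" and Mt: "transpose M = M"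
    using W M by (simp_all add: sym_mats_def)
  show "subspace (sym_mats \<times> sym_mats \<times> (UNIV :: (real^'m^'v) set))"
    by (intro subspace_Times subspace_sym_mats subspace_UNIV)
  show "(W, M, G) \<in> sym_mats \<times> sym_mats \<times> UNIV"
    using W M by simp
  have "?Q \<in> sym_mats"
    using sym_mats_calB[of B G] Wt
    by (simp add: sym_mats_def transpose_add matrix_transpose_mul add.commute)
  then show "(?R, ?Q, 2 *\<^sub>R ?K) \<in> sym_mats \<times> sym_mats \<times> UNIV"
    using sym_mats_residual[OF M] by simp
  fix h :: "(real^('n+'v)^('n+'v)) \<times> (real^('n+'v)^('n+'v)) \<times> (real^'m^'v)"
  assume "h \<in> sym_mats \<times> sym_mats \<times> UNIV"
  then obtain U X H where h: "h = (U, X, H)" and Ut: "transpose U = U" and Xt: "transpose X = X"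
    by (auto simp: sym_mats_def)
  let ?A = "calA A S L G" and ?b = "block_col B G"
  let ?c = "block_col 0 H :: real^'m^('n+'v)"
  let ?E = "block_mat 0 0 0 (H ** L) :: real^('n+'v)^('n+'v)"
  have U: "trace (U ** Y) = U \<bullet> Y" for Y
    by (simp add: inner_eq_trace Ut)
  have X: "trace (X ** Y) = X \<bullet> Y" for Y
    by (simp add: inner_eq_trace Xt)
  \<comment> \<open>Cyclic permutation brings \<open>X\<close> to the front and turns the Lyapunov
    operator into its adjoint, which now acts on \<open>W\<close>.\<close>
  have WX: "trace (W ** (transpose ?A ** X + X ** ?A)) = X \<bullet> (?A ** W + W ** transpose ?A)"
  proof -
    have "trace (W ** (transpose ?A ** X)) = trace (X ** (W ** transpose ?A))"
      by (metis matrix_mul_assoc trace_mul_sym)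
    moreover have "trace (W ** (X ** ?A)) = trace (X ** (?A ** W))"
      by (metis matrix_mul_assoc trace_mul_sym)
    ultimately show ?thesis
      by (simp add: X matrix_add_ldistrib trace_add inner_add_right)
  qed
  have Mb': "trace (M ** (?b ** transpose ?c + ?c ** transpose ?b))
      = 2 * (H \<bullet> (transpose M12 ** B + M22 ** G))"
  proof -
    have "trace (M ** (?c ** transpose ?b)) = trace (transpose (M ** ?b) ** ?c)"
      by (metis Mt matrix_mul_assoc matrix_transpose_mul trace_mul_sym)
    then have 1: "trace (M ** (?c ** transpose ?b)) = (M ** ?b) \<bullet> ?c"
      by (simp add: inner_eq_trace)
    have "trace (M ** (?b ** transpose ?c)) = trace (transpose ?c ** (M ** ?b))"
      by (metis matrix_mul_assoc trace_mul_sym)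
    then have 2: "trace (M ** (?b ** transpose ?c)) = (M ** ?b) \<bullet> ?c"
      using inner_eq_trace[of ?c "M ** ?b"] by (simp add: inner_commute)
    \<comment> \<open>The upper block of \<open>?c\<close> is zero, so only the lower block of
      \<open>M ** ?b\<close> survives.\<close>
    have "(M ** ?b) \<bullet> ?c = H \<bullet> (transpose M12 ** B + M22 ** G)"
      by (simp add: Mb block_mat_mult_block_col inner_block_col inner_commute)
    then show ?thesis
      by (simp add: 1 2 matrix_add_ldistrib trace_add)
  qed
  have WE: "trace (W ** (transpose ?E ** M + M ** ?E))
      = 2 * (H \<bullet> (transpose M12 ** W12 ** transpose L + M22 ** W22 ** transpose L))"
  proof -
    have 1: "trace (W ** (M ** ?E)) = (M ** W) \<bullet> ?E"
      by (simp add: inner_eq_trace matrix_transpose_mul Mt Wt matrix_mul_assoc)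
    have "trace (W ** (transpose ?E ** M)) = trace (transpose ?E ** (M ** W))"
      by (metis matrix_mul_assoc trace_mul_sym)
    then have 2: "trace (W ** (transpose ?E ** M)) = (M ** W) \<bullet> ?E"
      using inner_eq_trace[of ?E "M ** W"] by (simp add: inner_commute)
    \<comment> \<open>Only the lower right block of \<open>?E\<close> is nonzero, so only that block
      of \<open>M ** W\<close> enters.\<close>
    have "(M ** W) \<bullet> ?E = (transpose M12 ** W12 + M22 ** W22) \<bullet> (H ** L)"
      by (simp add: Mb Wb block_mat_mult_block_mat inner_block_mat)
    also have "\<dots> = H \<bullet> (transpose M12 ** W12 ** transpose L + M22 ** W22 ** transpose L)"
      by (simp add: inner_matrix_mult_right
          bounded_bilinear.add_left[OF bounded_bilinear_matrix_matrix_mult])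
    finally show ?thesis
      by (simp add: 1 2 matrix_add_ldistrib trace_add)
  qed
  \<comment> \<open>The part due to the variation of \<open>X\<close> is separated from the part due
    to that of \<open>G\<close>, matching \<open>WX\<close> and \<open>WE\<close>.\<close>
  have split: "W ** (transpose ?A ** X + X ** ?A - transpose ?E ** M - M ** ?E)
      = W ** (transpose ?A ** X + X ** ?A) - W ** (transpose ?E ** M + M ** ?E)"
    by (simp add: bounded_bilinear.diff_right[OF bounded_bilinear_matrix_matrix_mult]
        matrix_add_ldistrib)
  show "(case h of (U, X, H) \<Rightarrow> trace (X ** calB B G)
     + trace (M ** (block_col B G ** transpose (block_col 0 H)
                  + block_col 0 H ** transpose (block_col B G)))
     + trace (U ** residual A C S L P M G)
     + trace (W ** (transpose (calA A S L G) ** X + X ** calA A S L G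
                  - transpose (block_mat 0 0 0 (H ** L)) ** M - M ** block_mat 0 0 0 (H ** L))))
     = h \<bullet> (?R, ?Q, 2 *\<^sub>R ?K)"
    unfolding h prod.case split trace_sub WX Mb' WE U X
    by (simp add: inner_add_right inner_diff_right)
qed

theorem theorem3p7:
  fixes A :: "real^'n^'n" and B :: "real^'m^'n" and C :: "real^'n^'p"
    and S :: "real^'v^'v" and L :: "real^'v^'m" and P :: "real^'v^'n"
    and W M :: "real^('n+'v)^('n+'v)" and G :: "real^'m^'v"
    and W11 M11 :: "real^'n^'n" and W12 M12 :: "real^'v^'n" and W22 M22 :: "real^'v^'v"
  assumes "minimal_realization A B C"
    and "spectrum A \<subseteq> left_half_plane"
    and "observable L S"
    and "spectrum S \<inter> spectrum A = {}"
    and "A ** P + B ** L = P ** S"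
    and "W \<in> sym_mats" and "M \<in> sym_mats"
    and "W = block_mat W11 W12 (transpose W12) W22"
    and "M = block_mat M11 M12 (transpose M12) M22"
  shows "grad_lagrangian A B C S L P (W, M, G) = 0 \<longleftrightarrow>
     transpose (calA A S L G) ** M + M ** calA A S L G + calC C P = 0 \<and>
     calA A S L G ** W + W ** transpose (calA A S L G) + calB B G = 0 \<and>
     transpose M12 ** B + M22 ** G
       - transpose M12 ** W12 ** transpose L - M22 ** W22 ** transpose L = 0"
  \<comment> \<open>A triple vanishes iff each component does, and the nonzero factor
    \<open>2\<close> drops out of the third equation.\<close>
  unfolding grad_lagrangian_eq[OF assms(6-9)] residual_def
  by (simp add: zero_prod_def)

end
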